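(* Let $n\ge1$ be an integer, $\mathbb{K}$ a field of characteristic zero and $H=\mathbb{K}\mathbb{Z}_n$ the group Hopf algebra of the cyclic group of order $n$. Let $\lambda_{H^*}:H^*\to \operatorname{End}(H^* )\equiv M_n(\mathbb{K})$ and $\lambda_H:H\to\operatorname{End}(H^* )\equiv M_n(\mathbb{K})$ be the algebra embeddings given by $\lambda_{H^*}(\varphi)(\psi)=\varphi*\psi$ and $\lambda_H(h)(\psi)=h\rightharpoonup\psi$. Then: (1) the image of $(\mathbb{K}\mathbb{Z}_n)^*$ in $M_n(\mathbb{K})$ under $\lambda_{H^*}$ is the algebra $D^n_{\mathbb{K}}$ of diagonal $n\times n$ matrices; (2) the image of $\mathbb{K}\mathbb{Z}_n$ in $M_n(\mathbb{K})$ under $\lambda_{H}$ is the algebra $C^n_{\mathbb{K}}$ of circulant $n\times n$ matrices, and $\lambda_{\mathbb{K}\mathbb{Z}_n}$ coincides with the algebra isomorphism $g:\mathbb{K}\mathbb{Z}_n\to C^n_{\mathbb{K}}$, $g(c_1e_1+\dots+c_ne_n)=\operatorname{circ}(c_1,\dots,c_n)$.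
   Context: $\mathbb{Z}_n$ has elements $e_1,\dots,e_n$ where $e_i$ is the class of $i-1$, so $e_ie_j=e_{i+j-1}$ (subscripts mod $n$). $\mathbb{K}\mathbb{Z}_n$ has its usual Hopf algebra structure, in particular $\Delta(e_i)=e_i\otimes e_i$. $\operatorname{circ}(c_1,\dots,c_n)$ is the $n\times n$ matrix with $(i,j)$ entry $c_{j-i+1}$ (subscripts mod $n$). For a finite dimensional Hopf algebra $H$, $*$ is the convolution product on $H^*$, $(\varphi*\psi)(h)=\varphi(h_1)\psi(h_2)$ with $\Delta(h)=h_1\otimes h_2$ (Sweedler notation), and $\rightharpoonup$ is the left regular action of $H$ on $H^*$, $(h\rightharpoonup\varphi)(h')=\varphi(h'h)$. The identification $\operatorname{End}((\mathbb{K}\mathbb{Z}_n)^* )\equiv M_n(\mathbb{K})$ is via the basis $\{p_1,\dots,p_n\}$ of $(\mathbb{K}\mathbb{Z}_n)^*$ dual to $\{e_1,\dots,e_n\}$: an endomorphism $f$ with $f(p_j)=\sum_{i=1}^na_{ij}p_i$ is identified with the matrix $(a_{ij})_{1\le i,j\le n}$. *)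

theory Defs
  imports
    "HOL-Library.Poly_Mapping"
    "HOL-Algebra.Module"
    "Berlekamp_Zassenhaus.Finite_Field"
    "Jordan_Normal_Form.Matrix"
begin

section \<open>Algebras over a field\<close>

text \<open>
  An algebra over the field \<open>'k\<close> is given as a record of type \<open>('k, 'a) module\<close> (which extends
  the ring record by a scalar multiplication).
\<close>

definition alg_hom :: "('k, 'a) module \<Rightarrow> ('k, 'b) module \<Rightarrow> ('a \<Rightarrow> 'b) set" where
  "alg_hom A B = {f \<in> Ring.ring_hom A B.
     \<forall>c. \<forall>x \<in> carrier A. f (c \<odot>\<^bsub>A\<^esub> x) = c \<odot>\<^bsub>B\<^esub> f x}"

definition alg_embedding :: "('k, 'a) module \<Rightarrow> ('k, 'b) module \<Rightarrow> ('a \<Rightarrow> 'b) set" where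
  "alg_embedding A B = {f \<in> alg_hom A B. inj_on f (carrier A)}"

definition alg_iso :: "('k, 'a) module \<Rightarrow> ('k, 'b) module \<Rightarrow> ('a \<Rightarrow> 'b) set" where
  "alg_iso A B = {f \<in> alg_hom A B. bij_betw f (carrier A) (carrier B)}"


section \<open>The group Hopf algebra and its dual\<close>

text \<open>
  The group algebra of an additively written group \<open>'g\<close> is the type \<open>'g \<Rightarrow>\<^sub>0 'k\<close>, whose library
  multiplication is the convolution of coefficient functions; the group element \<open>a\<close> is
  \<open>Poly_Mapping.single a 1\<close>.
\<close>

abbreviation gelem :: "'g \<Rightarrow> ('g \<Rightarrow>\<^sub>0 'k::field)" where
  "gelem a \<equiv> Poly_Mapping.single a 1"

definition gscale :: "'k::field \<Rightarrow> ('g \<Rightarrow>\<^sub>0 'k) \<Rightarrow> ('g \<Rightarrow>\<^sub>0 'k)" where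
  "gscale c = Poly_Mapping.map ((*) c)"

definition group_alg :: "('k::field, 'g::group_add \<Rightarrow>\<^sub>0 'k) module" where
  "group_alg = \<lparr>carrier = UNIV, monoid.mult = (*), monoid.one = 1, ring.zero = 0,
     ring.add = (+), module.smult = gscale\<rparr>"

text \<open>
  The tensor square of the group algebra of \<open>'g\<close> is realised as the space with basis
  \<open>'g \<times> 'g\<close>, the basis vector \<open>(a, b)\<close> being \<open>a \<otimes> b\<close>.
\<close>

definition tensor :: "('g \<Rightarrow>\<^sub>0 'k::field) \<Rightarrow> ('g \<Rightarrow>\<^sub>0 'k) \<Rightarrow> ('g \<times> 'g \<Rightarrow>\<^sub>0 'k)" where
  "tensor x y = (\<Sum>a\<in>Poly_Mapping.keys x. \<Sum>b\<in>Poly_Mapping.keys y.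
     Poly_Mapping.single (a, b) (Poly_Mapping.lookup x a * Poly_Mapping.lookup y b))"

definition comult :: "('g \<Rightarrow>\<^sub>0 'k::field) \<Rightarrow> ('g \<times> 'g \<Rightarrow>\<^sub>0 'k)" where
  "comult h = (\<Sum>a\<in>Poly_Mapping.keys h.
     gscale (Poly_Mapping.lookup h a) (tensor (gelem a) (gelem a)))"

definition counit :: "('g \<Rightarrow>\<^sub>0 'k::field) \<Rightarrow> 'k" where
  "counit h = (\<Sum>a\<in>Poly_Mapping.keys h. Poly_Mapping.lookup h a)"

definition dual :: "(('g \<Rightarrow>\<^sub>0 'k::field) \<Rightarrow> 'k) set" where
  "dual = {\<phi>. Vector_Spaces.linear gscale (*) \<phi>}"

text \<open>
  For linear \<open>\<phi>\<close> and \<open>\<psi>\<close>, this is the linear form \<open>x \<otimes> y \<mapsto> \<phi> x * \<psi> y\<close> on the tensor square.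
\<close>

definition tensor_form ::
  "(('g \<Rightarrow>\<^sub>0 'k::field) \<Rightarrow> 'k) \<Rightarrow> (('g \<Rightarrow>\<^sub>0 'k) \<Rightarrow> 'k) \<Rightarrow> ('g \<times> 'g \<Rightarrow>\<^sub>0 'k) \<Rightarrow> 'k" where
  "tensor_form \<phi> \<psi> t =
     (\<Sum>(a, b)\<in>Poly_Mapping.keys t.
        Poly_Mapping.lookup t (a, b) * (\<phi> (gelem a) * \<psi> (gelem b)))"

definition conv ::
  "(('g \<Rightarrow>\<^sub>0 'k::field) \<Rightarrow> 'k) \<Rightarrow> (('g \<Rightarrow>\<^sub>0 'k) \<Rightarrow> 'k) \<Rightarrow> ('g \<Rightarrow>\<^sub>0 'k) \<Rightarrow> 'k" where
  "conv \<phi> \<psi> h = tensor_form \<phi> \<psi> (comult h)"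

definition act ::
  "('g::group_add \<Rightarrow>\<^sub>0 'k::field) \<Rightarrow> (('g \<Rightarrow>\<^sub>0 'k) \<Rightarrow> 'k) \<Rightarrow> ('g \<Rightarrow>\<^sub>0 'k) \<Rightarrow> 'k" where
  "act h \<phi> h' = \<phi> (h' * h)"

definition dual_alg :: "('k::field, ('g \<Rightarrow>\<^sub>0 'k) \<Rightarrow> 'k) module" where
  "dual_alg = \<lparr>carrier = dual, monoid.mult = conv, monoid.one = counit, ring.zero = (\<lambda>_. 0),
     ring.add = (\<lambda>\<phi> \<psi> h. \<phi> h + \<psi> h), module.smult = (\<lambda>c \<phi> h. c * \<phi> h)\<rparr>"

text \<open>
  Linear endomorphisms of the dual are represented by functions that are \<open>undefined\<close> outside of
  \<open>dual\<close>, so that equality of endomorphisms is equality in HOL.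
\<close>

definition End_dual :: "((('g \<Rightarrow>\<^sub>0 'k::field) \<Rightarrow> 'k) \<Rightarrow> (('g \<Rightarrow>\<^sub>0 'k) \<Rightarrow> 'k)) set" where
  "End_dual = {f \<in> dual \<rightarrow>\<^sub>E dual.
     (\<forall>\<phi>\<in>dual. \<forall>\<psi>\<in>dual. f (\<lambda>h. \<phi> h + \<psi> h) = (\<lambda>h. f \<phi> h + f \<psi> h)) \<and>
     (\<forall>c. \<forall>\<phi>\<in>dual. f (\<lambda>h. c * \<phi> h) = (\<lambda>h. c * f \<phi> h))}"

definition End_dual_alg ::
  "('k::field, (('g \<Rightarrow>\<^sub>0 'k) \<Rightarrow> 'k) \<Rightarrow> (('g \<Rightarrow>\<^sub>0 'k) \<Rightarrow> 'k)) module" where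
  "End_dual_alg = \<lparr>carrier = End_dual, monoid.mult = compose dual, monoid.one = (\<lambda>\<phi>\<in>dual. \<phi>),
     ring.zero = (\<lambda>\<phi>\<in>dual. \<lambda>_. 0), ring.add = (\<lambda>f g. \<lambda>\<phi>\<in>dual. \<lambda>h. f \<phi> h + g \<phi> h),
     module.smult = (\<lambda>c f. \<lambda>\<phi>\<in>dual. \<lambda>h. c * f \<phi> h)\<rparr>"

definition lambda_dual ::
  "(('g \<Rightarrow>\<^sub>0 'k::field) \<Rightarrow> 'k) \<Rightarrow> (('g \<Rightarrow>\<^sub>0 'k) \<Rightarrow> 'k) \<Rightarrow> (('g \<Rightarrow>\<^sub>0 'k) \<Rightarrow> 'k)" where
  "lambda_dual \<phi> = (\<lambda>\<psi>\<in>dual. conv \<phi> \<psi>)"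

definition lambda_alg ::
  "('g::group_add \<Rightarrow>\<^sub>0 'k::field) \<Rightarrow> (('g \<Rightarrow>\<^sub>0 'k) \<Rightarrow> 'k) \<Rightarrow> (('g \<Rightarrow>\<^sub>0 'k) \<Rightarrow> 'k)" where
  "lambda_alg h = (\<lambda>\<psi>\<in>dual. act h \<psi>)"


section \<open>Matrices\<close>

text \<open>
  Library matrices have rows and columns numbered from \<open>0\<close>; the \<open>(i, j)\<close> entry in \<open>1\<close>-based
  numbering is \<open>A $$ (i - 1, j - 1)\<close>.
\<close>

definition matrix_alg :: "nat \<Rightarrow> ('k::field, 'k mat) module" where
  "matrix_alg n = \<lparr>carrier = carrier_mat n n, monoid.mult = (*), monoid.one = 1\<^sub>m n,
     ring.zero = 0\<^sub>m n n, ring.add = (+), module.smult = (\<cdot>\<^sub>m)\<rparr>"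

definition diagonals :: "nat \<Rightarrow> 'k::field mat set" where
  "diagonals n = {A \<in> carrier_mat n n. diagonal_mat A}"

text \<open>
  The arguments of \<open>circ\<close> are \<open>c 1, \<dots>, c n\<close>. The index \<open>j - i + 1\<close>, taken modulo \<open>n\<close> in
  \<open>{1..n}\<close>, is \<open>(j - i) mod n + 1\<close>, and the difference \<open>j - i\<close> does not depend on whether the
  numbering of rows and columns starts from \<open>0\<close> or \<open>1\<close>.
\<close>

definition circ :: "nat \<Rightarrow> (nat \<Rightarrow> 'k) \<Rightarrow> 'k mat" where
  "circ n c = mat n n (\<lambda>(i, j). c (nat ((int j - int i) mod int n) + 1))"

definition circulants :: "nat \<Rightarrow> 'k::field mat set" where
  "circulants n = range (circ n)"

definition circulant_alg :: "nat \<Rightarrow> ('k::field, 'k mat) module" where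
  "circulant_alg n = matrix_alg n\<lparr>carrier := circulants n\<rparr>"


section \<open>The cyclic group of order \<open>CARD('n)\<close>\<close>

text \<open>
  The additive group of \<open>'n mod_ring\<close> is the group of integers modulo \<open>CARD('n)\<close>, for any
  finite type \<open>'n\<close>, including those with one element. The basis vector \<open>e_i\<close> of the group
  algebra, \<open>1 \<le> i \<le> n\<close>, is \<open>basis i\<close> and corresponds to the class of \<open>i - 1\<close>; \<open>dual_basis i\<close>
  is the dual basis vector \<open>p_i\<close>.
\<close>

definition basis :: "nat \<Rightarrow> ('n::finite mod_ring \<Rightarrow>\<^sub>0 'k::field)" where
  "basis i = gelem (of_int_mod_ring (int i - 1))"

definition dual_basis :: "nat \<Rightarrow> ('n::finite mod_ring \<Rightarrow>\<^sub>0 'k::field) \<Rightarrow> 'k" where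
  "dual_basis i h = Poly_Mapping.lookup h (of_int_mod_ring (int i - 1))"

definition matrix_of ::
  "((('n::finite mod_ring \<Rightarrow>\<^sub>0 'k::field) \<Rightarrow> 'k) \<Rightarrow> (('n mod_ring \<Rightarrow>\<^sub>0 'k) \<Rightarrow> 'k)) \<Rightarrow> 'k mat" where
  "matrix_of f = (THE A. A \<in> carrier_mat CARD('n) CARD('n) \<and>
     (\<forall>j\<in>{1..CARD('n)}. f (dual_basis j) =
        (\<lambda>h. \<Sum>i=1..CARD('n). A $$ (i - 1, j - 1) * dual_basis i h)))"

text \<open>The map \<open>c 1 * e_1 + \<dots> + c n * e_n \<mapsto> circ n c\<close>.\<close>

definition circ_map :: "('n::finite mod_ring \<Rightarrow>\<^sub>0 'k::field) \<Rightarrow> 'k mat" where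
  "circ_map h = circ CARD('n) (\<lambda>i. dual_basis i h)"

end

theory Submission
  imports Defs
begin

text \<open>
  The group elements form a basis of the group algebra, so a linear form is the same thing as an
  arbitrary function on the group. Since \<open>\<Delta>(a) = a \<otimes> a\<close> for a group element \<open>a\<close>, convolution
  is pointwise multiplication of these functions (\<open>conv_gelem\<close>), with the constant function 1
  as its unit. Hence convolution by \<open>\<phi>\<close> multiplies the delta function \<open>p_i\<close> by the number
  \<open>\<phi>(e_i)\<close>: its matrix is diagonal, with the values of \<open>\<phi>\<close> on the diagonal, and these values
  are arbitrary (\<open>image_lambda_dual\<close>).

  The \<open>(i, j)\<close> entry of the matrix of an endomorphism \<open>f\<close> is \<open>f(p_j)(e_i)\<close>
  (\<open>matrix_of_eq\<close>). For the left regular action of \<open>h\<close> it is \<open>p_j(e_i h)\<close>, the coefficient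
  in \<open>h\<close> of the group element \<open>(j - 1) - (i - 1) = j - i\<close>, because left multiplication by a
  group element translates coefficients (\<open>lookup_gelem_mult\<close>). So this matrix is the circulant
  of the coefficients of \<open>h\<close> (\<open>matrix_of_lambda_alg\<close>).

  That \<open>\<lambda>\<close> embeds either algebra into the endomorphisms of the dual holds for every group:
  multiplicativity is associativity of the product concerned, and injectivity follows from
  \<open>\<phi> * \<epsilon> = \<phi>\<close> on one side and from \<open>(h \<rightharpoonup> \<psi>)(1) = \<psi>(h)\<close> on the other. The map \<open>g\<close> is
  the composite of \<open>\<lambda>\<close> with the isomorphism onto matrices, so it is multiplicative without any
  computation with products of circulant matrices, and circulants are closed under
  multiplication because they are its image (\<open>circ_map_iso\<close>).
\<close>


section \<open>Homomorphisms of algebras\<close>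

lemma alg_homI:
  assumes "\<And>x. x \<in> carrier A \<Longrightarrow> f x \<in> carrier B"
    and "\<And>x y. \<lbrakk>x \<in> carrier A; y \<in> carrier A\<rbrakk> \<Longrightarrow> f (x \<otimes>\<^bsub>A\<^esub> y) = f x \<otimes>\<^bsub>B\<^esub> f y"
    and "\<And>x y. \<lbrakk>x \<in> carrier A; y \<in> carrier A\<rbrakk> \<Longrightarrow> f (x \<oplus>\<^bsub>A\<^esub> y) = f x \<oplus>\<^bsub>B\<^esub> f y"
    and "f \<one>\<^bsub>A\<^esub> = \<one>\<^bsub>B\<^esub>"
    and "\<And>c x. x \<in> carrier A \<Longrightarrow> f (c \<odot>\<^bsub>A\<^esub> x) = c \<odot>\<^bsub>B\<^esub> f x"
  shows "f \<in> alg_hom A B"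
  using assms unfolding alg_hom_def by (auto intro!: ring_hom_memI)

lemma alg_embedding_comp_iso:
  assumes f: "f \<in> alg_embedding A B" and g: "g \<in> alg_iso B C"
  shows "g \<circ> f \<in> alg_embedding A C"
proof -
  have fr: "f \<in> Ring.ring_hom A B" and gr: "g \<in> Ring.ring_hom B C"
    and fi: "inj_on f (carrier A)" and gi: "inj_on g (carrier B)"
    using f g by (auto simp: alg_embedding_def alg_iso_def alg_hom_def bij_betw_def)
  have im: "f x \<in> carrier B" if "x \<in> carrier A" for x
    using ring_hom_closed[OF fr that] .
  have "inj_on g (f ` carrier A)"
    using im by (intro inj_on_subset[OF gi]) auto
  then show ?thesis
    using ring_hom_trans[OF fr gr] comp_inj_on[OF fi] f g im
    by (auto simp: alg_embedding_def alg_iso_def alg_hom_def)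
qed

lemma alg_embedding_onto_image:
  assumes "f \<in> alg_embedding A B"
  shows "f \<in> alg_iso A (B\<lparr>carrier := f ` carrier A\<rparr>)"
  using assms
  by (auto simp: alg_embedding_def alg_iso_def alg_hom_def Ring.ring_hom_def bij_betw_def)


section \<open>Linear forms on a group algebra and their endomorphisms\<close>

lemma lookup_gscale [simp]:
  "Poly_Mapping.lookup (gscale c x) a = c * Poly_Mapping.lookup x a"
  by (simp add: gscale_def Poly_Mapping.map.rep_eq when_def)

lemma vector_space_gscale:
  "vector_space (gscale :: 'k::field \<Rightarrow> ('g \<Rightarrow>\<^sub>0 'k) \<Rightarrow> _)"
  by unfold_locales
    (auto intro!: poly_mapping_eqI simp: lookup_add algebra_simps)

lemma vector_space_mult: "vector_space ((*) :: 'k::field \<Rightarrow> 'k \<Rightarrow> 'k)"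
  by unfold_locales (auto simp: algebra_simps)

lemma dual_iff:
  "\<phi> \<in> dual \<longleftrightarrow> (\<forall>x y. \<phi> (x + y) = \<phi> x + \<phi> y) \<and> (\<forall>c x. \<phi> (gscale c x) = c * \<phi> x)"
  unfolding dual_def Vector_Spaces.linear_iff
  using vector_space_gscale vector_space_mult by auto

lemma dual_apply_sum:
  fixes \<phi> :: "('g \<Rightarrow>\<^sub>0 'k::field) \<Rightarrow> 'k"
  assumes "\<phi> \<in> dual"
  shows "\<phi> (\<Sum>i\<in>I. x i) = (\<Sum>i\<in>I. \<phi> (x i))"
proof -
  have "\<phi> (gscale 0 0) = 0"
    using assms by (simp add: dual_iff)
  moreover have "gscale 0 0 = (0 :: 'g \<Rightarrow>\<^sub>0 'k)"
    by (rule poly_mapping_eqI) simp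
  ultimately have "\<phi> 0 = 0" by simp
  then show ?thesis
    using assms by (induction I rule: infinite_finite_induct) (auto simp: dual_iff)
qed

lemma gelem_expansion:
  "h = (\<Sum>a\<in>Poly_Mapping.keys h. gscale (Poly_Mapping.lookup h a) (gelem a))"
  by (rule poly_mapping_eqI)
    (auto simp: lookup_sum lookup_single when_def in_keys_iff if_distrib cong: if_cong)

lemma dual_eval:
  assumes "\<phi> \<in> dual"
  shows "\<phi> h = (\<Sum>a\<in>Poly_Mapping.keys h. Poly_Mapping.lookup h a * \<phi> (gelem a))"
proof -
  have "\<phi> h = \<phi> (\<Sum>a\<in>Poly_Mapping.keys h. gscale (Poly_Mapping.lookup h a) (gelem a))"
    by (rule arg_cong[OF gelem_expansion])
  then show ?thesis
    using assms by (simp add: dual_apply_sum) (simp add: dual_iff)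
qed

lemma dual_eqI:
  assumes "\<phi> \<in> dual" "\<psi> \<in> dual" "\<And>a. \<phi> (gelem a) = \<psi> (gelem a)"
  shows "\<phi> = \<psi>"
proof
  show "\<phi> h = \<psi> h" for h
    unfolding dual_eval[OF assms(1), of h] dual_eval[OF assms(2), of h]
    by (simp only: assms(3))
qed

text \<open>
  The source of linear forms defined by their values on the group: the sum over the keys of \<open>h\<close>,
  which vary with \<open>h\<close>, can be replaced by one over a common finite superset, on which linearity
  is evident.
\<close>

lemma extension_by_linearity_dual:
  "(\<lambda>h. \<Sum>a\<in>Poly_Mapping.keys h. Poly_Mapping.lookup h a * v a) \<in> dual" (is "?\<phi> \<in> _")
proof -
  \<comment> \<open>The coefficients vanish outside the keys.\<close>
  have over: "?\<phi> h = (\<Sum>a\<in>S. Poly_Mapping.lookup h a * v a)"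
    if "finite S" "Poly_Mapping.keys h \<subseteq> S" for h S
    using that by (intro sum.mono_neutral_left) (auto simp: in_keys_iff)
  have "?\<phi> (x + y) = ?\<phi> x + ?\<phi> y" for x y
    using keys_add[of x y]
    by (simp only: over[of "Poly_Mapping.keys x \<union> Poly_Mapping.keys y"] finite_Un finite_keys
        simp_thms Un_upper1 Un_upper2)
      (simp add: lookup_add sum.distrib distrib_right)
  moreover have "?\<phi> (gscale c x) = c * ?\<phi> x" for c x
    using over[of "Poly_Mapping.keys x" "gscale c x"]
    by (simp add: in_keys_iff subset_iff sum_distrib_left algebra_simps)
  ultimately show ?thesis by (simp add: dual_iff)
qed

lemma lookup_dual: "(\<lambda>h. Poly_Mapping.lookup h a) \<in> dual"
  by (simp add: dual_iff lookup_add)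

lemma zero_dual: "(\<lambda>_. 0) \<in> dual"
  by (simp add: dual_iff)

lemma add_dual: "\<phi> \<in> dual \<Longrightarrow> \<psi> \<in> dual \<Longrightarrow> (\<lambda>h. \<phi> h + \<psi> h) \<in> dual"
  by (simp add: dual_iff algebra_simps)

lemma scale_dual: "\<phi> \<in> dual \<Longrightarrow> (\<lambda>h. c * \<phi> h) \<in> dual"
  by (simp add: dual_iff algebra_simps)

lemma sum_dual: "(\<And>i. i \<in> I \<Longrightarrow> \<phi> i \<in> dual) \<Longrightarrow> (\<lambda>h. \<Sum>i\<in>I. \<phi> i h) \<in> dual"
  by (induction I rule: infinite_finite_induct) (auto simp: zero_dual add_dual)

lemmas dual_intros = lookup_dual zero_dual add_dual scale_dual sum_dual


lemma End_dual_closed: "f \<in> End_dual \<Longrightarrow> \<phi> \<in> dual \<Longrightarrow> f \<phi> \<in> dual"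
  by (auto simp: End_dual_def)

text \<open>
  An element of \<open>End_dual\<close> must be \<open>undefined\<close> outside of \<open>dual\<close>, hence the restriction in the
  conclusion.
\<close>

lemma End_dualI:
  assumes "\<And>\<phi>. \<phi> \<in> dual \<Longrightarrow> F \<phi> \<in> dual"
    and "\<And>\<phi> \<psi>. \<lbrakk>\<phi> \<in> dual; \<psi> \<in> dual\<rbrakk> \<Longrightarrow> F (\<lambda>h. \<phi> h + \<psi> h) = (\<lambda>h. F \<phi> h + F \<psi> h)"
    and "\<And>c \<phi>. \<phi> \<in> dual \<Longrightarrow> F (\<lambda>h. c * \<phi> h) = (\<lambda>h. c * F \<phi> h)"
  shows "(\<lambda>\<phi>\<in>dual. F \<phi>) \<in> End_dual"
  using assms by (auto simp: End_dual_def add_dual scale_dual)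


section \<open>Convolution on the dual\<close>

text \<open>
  The element \<open>\<Delta>(h)\<close> is supported on the diagonal of \<open>'g \<times> 'g\<close>, where it has the coefficients
  of \<open>h\<close>.
\<close>

lemma lookup_comult:
  "Poly_Mapping.lookup (comult h) (a, b) = (if a = b then Poly_Mapping.lookup h a else 0)"
  by (cases "a = b") (auto simp: comult_def tensor_def lookup_sum lookup_single when_def
      in_keys_iff if_distrib intro!: sum.neutral cong: if_cong)

lemma conv_eval:
  "conv \<phi> \<psi> h =
     (\<Sum>a\<in>Poly_Mapping.keys h. Poly_Mapping.lookup h a * (\<phi> (gelem a) * \<psi> (gelem a)))"
proof -
  have "Poly_Mapping.keys (comult h) = (\<lambda>a. (a, a)) ` Poly_Mapping.keys h"
    by (auto simp: in_keys_iff lookup_comult split: if_splits)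
  then show ?thesis
    by (simp add: conv_def tensor_form_def sum.reindex inj_on_def lookup_comult)
qed

lemma conv_gelem [simp]: "conv \<phi> \<psi> (gelem a) = \<phi> (gelem a) * \<psi> (gelem a)"
  by (simp add: conv_eval)

lemma conv_dual: "conv \<phi> \<psi> \<in> dual"
  using extension_by_linearity_dual[of "\<lambda>a. \<phi> (gelem a) * \<psi> (gelem a)"]
  by (simp add: conv_eval[abs_def])

lemma counit_gelem [simp]: "counit (gelem a) = 1"
  by (simp add: counit_def)

lemma counit_dual: "counit \<in> dual"
  using extension_by_linearity_dual[of "\<lambda>_. 1"] by (simp add: counit_def[abs_def])

text \<open>
  Under evaluation at group elements every algebra law for \<open>conv\<close> is the corresponding law of the
  field. For injectivity, \<open>\<phi>\<close> is recovered as \<open>\<phi> * \<epsilon>\<close>.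
\<close>

lemma lambda_dual_embedding:
  "lambda_dual \<in> alg_embedding (dual_alg :: ('k::field, ('g \<Rightarrow>\<^sub>0 'k) \<Rightarrow> 'k) module) End_dual_alg"
proof -
  have "lambda_dual \<in> alg_hom (dual_alg :: ('k, ('g \<Rightarrow>\<^sub>0 'k) \<Rightarrow> 'k) module) End_dual_alg"
  proof (rule alg_homI, simp_all add: dual_alg_def End_dual_alg_def)
    show "lambda_dual \<phi> \<in> End_dual" for \<phi> :: "('g \<Rightarrow>\<^sub>0 'k) \<Rightarrow> 'k"
      unfolding lambda_dual_def
      by (intro End_dualI conv_dual)
        (auto intro!: dual_eqI dual_intros conv_dual simp: algebra_simps)
    show "lambda_dual (conv \<phi> \<psi>) = compose dual (lambda_dual \<phi>) (lambda_dual \<psi>)"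
      for \<phi> \<psi> :: "('g \<Rightarrow>\<^sub>0 'k) \<Rightarrow> 'k"
      by (auto simp: lambda_dual_def compose_def conv_dual fun_eq_iff conv_eval algebra_simps)
    show "lambda_dual (\<lambda>h. \<phi> h + \<psi> h) = (\<lambda>\<xi>\<in>dual. \<lambda>h. lambda_dual \<phi> \<xi> h + lambda_dual \<psi> \<xi> h)"
      for \<phi> \<psi> :: "('g \<Rightarrow>\<^sub>0 'k) \<Rightarrow> 'k"
      by (auto simp: lambda_dual_def fun_eq_iff conv_eval algebra_simps sum.distrib)
    show "lambda_dual (\<lambda>h. c * \<phi> h) = (\<lambda>\<xi>\<in>dual. \<lambda>h. c * lambda_dual \<phi> \<xi> h)"
      for \<phi> :: "('g \<Rightarrow>\<^sub>0 'k) \<Rightarrow> 'k" and c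
      by (auto simp: lambda_dual_def fun_eq_iff conv_eval algebra_simps sum_distrib_left)
    show "lambda_dual (counit :: ('g \<Rightarrow>\<^sub>0 'k) \<Rightarrow> 'k) = (\<lambda>\<phi>\<in>dual. \<phi>)"
      unfolding lambda_dual_def
      by (rule restrict_ext) (auto intro!: dual_eqI conv_dual)
  qed
  moreover have "inj_on lambda_dual (dual :: (('g \<Rightarrow>\<^sub>0 'k) \<Rightarrow> 'k) set)"
  proof (rule inj_onI, rule dual_eqI)
    fix \<phi> \<psi> :: "('g \<Rightarrow>\<^sub>0 'k) \<Rightarrow> 'k" and a
    assume "lambda_dual \<phi> = lambda_dual \<psi>"
    then have "lambda_dual \<phi> counit (gelem a) = lambda_dual \<psi> counit (gelem a)" by simp
    then show "\<phi> (gelem a) = \<psi> (gelem a)"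
      by (simp add: lambda_dual_def counit_dual)
  qed
  ultimately show ?thesis
    by (simp add: alg_embedding_def dual_alg_def)
qed


section \<open>The left regular action\<close>

lemma gscale_mult_left: "gscale c x * y = gscale c (x * y)"
  for x y :: "'g::monoid_add \<Rightarrow>\<^sub>0 'k::field"
  by (simp add: gscale_def mult_map_scale_conv_mult mult.assoc)

text \<open>
  Multiplication by the scalar \<open>c\<close> is left multiplication by the multiple \<open>c\<close> of the neutral
  element of the group. This multiple is central, although the group may not be commutative.
\<close>

lemma gscale_mult_right: "x * gscale c y = gscale c (x * y)"
  for x y :: "'g::monoid_add \<Rightarrow>\<^sub>0 'k::field"
proof -
  have "x * Poly_Mapping.single 0 c =
      (\<Sum>a\<in>Poly_Mapping.keys x. gscale (Poly_Mapping.lookup x a) (gelem a)) * Poly_Mapping.single 0 c"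
    by (rule arg_cong[OF gelem_expansion])
  also have "\<dots> = (\<Sum>a\<in>Poly_Mapping.keys x. Poly_Mapping.single a (c * Poly_Mapping.lookup x a))"
    by (simp add: sum_distrib_right mult_single gscale_def mult.commute)
  also have "\<dots> = gscale c x"
    by (rule poly_mapping_eqI)
      (auto simp: lookup_sum lookup_single when_def in_keys_iff if_distrib cong: if_cong)
  finally show ?thesis
    by (simp add: gscale_def mult_map_scale_conv_mult flip: mult.assoc)
qed

text \<open>
  Left multiplication by a group element permutes the basis, so it translates the coefficients.
\<close>

lemma lookup_gelem_mult:
  "Poly_Mapping.lookup (gelem a * h) b = Poly_Mapping.lookup h (- a + b)"
  for h :: "'g::group_add \<Rightarrow>\<^sub>0 'k::field"
proof -
  have "b = a + q \<longleftrightarrow> - a + b = q" for q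
    by (auto simp flip: add.assoc)
  then show ?thesis
    by (simp add: lookup_mult lookup_single when_mult)
qed

lemma act_dual: "\<phi> \<in> dual \<Longrightarrow> act h \<phi> \<in> dual"
  by (simp add: dual_iff act_def[abs_def] distrib_right gscale_mult_left)

text \<open>
  The action multiplies the argument on the right, so \<open>(x * y) \<rightharpoonup> \<psi>\<close> and \<open>x \<rightharpoonup> (y \<rightharpoonup> \<psi>)\<close>
  agree at \<open>h'\<close> by associativity, in the right order for noncommutative groups. For injectivity,
  the coefficient of \<open>h\<close> at \<open>a\<close> is recovered as the value at 1 of \<open>h\<close> acting on the coordinate
  form of \<open>a\<close>.
\<close>

lemma lambda_alg_embedding:
  "lambda_alg \<in> alg_embedding (group_alg :: ('k::field, 'g::group_add \<Rightarrow>\<^sub>0 'k) module) End_dual_alg"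
proof -
  have "lambda_alg \<in> alg_hom (group_alg :: ('k, 'g \<Rightarrow>\<^sub>0 'k) module) End_dual_alg"
  proof (rule alg_homI, simp_all add: group_alg_def End_dual_alg_def)
    show "lambda_alg h \<in> End_dual" for h :: "'g \<Rightarrow>\<^sub>0 'k"
      unfolding lambda_alg_def by (intro End_dualI act_dual) (auto simp: act_def)
    show "lambda_alg (x * y) = compose dual (lambda_alg x) (lambda_alg y)" for x y :: "'g \<Rightarrow>\<^sub>0 'k"
      by (auto simp: lambda_alg_def compose_def act_dual fun_eq_iff) (simp add: act_def mult.assoc)
    show "lambda_alg (x + y) = (\<lambda>\<phi>\<in>dual. \<lambda>h. lambda_alg x \<phi> h + lambda_alg y \<phi> h)"
      for x y :: "'g \<Rightarrow>\<^sub>0 'k"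
      by (auto simp: lambda_alg_def fun_eq_iff act_def distrib_left dual_iff)
    show "lambda_alg (gscale c x) = (\<lambda>\<phi>\<in>dual. \<lambda>h. c * lambda_alg x \<phi> h)"
      for x :: "'g \<Rightarrow>\<^sub>0 'k" and c
      by (auto simp: lambda_alg_def fun_eq_iff act_def gscale_mult_right dual_iff)
    show "lambda_alg (1 :: 'g \<Rightarrow>\<^sub>0 'k) = (\<lambda>\<phi>\<in>dual. \<phi>)"
      by (auto simp: lambda_alg_def fun_eq_iff act_def)
  qed
  moreover have "inj (lambda_alg :: ('g \<Rightarrow>\<^sub>0 'k) \<Rightarrow> _)"
  proof (rule injI, rule poly_mapping_eqI)
    fix x y :: "'g \<Rightarrow>\<^sub>0 'k" and a
    assume "lambda_alg x = lambda_alg y"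
    then have "lambda_alg x (\<lambda>h. Poly_Mapping.lookup h a) 1
        = lambda_alg y (\<lambda>h. Poly_Mapping.lookup h a) 1"
      by simp
    then show "Poly_Mapping.lookup x a = Poly_Mapping.lookup y a"
      by (simp add: lambda_alg_def lookup_dual act_def)
  qed
  ultimately show ?thesis
    by (simp add: alg_embedding_def group_alg_def)
qed


section \<open>Matrices of endomorphisms of the dual\<close>

abbreviation residue :: "nat \<Rightarrow> 'n::finite mod_ring" where
  "residue i \<equiv> of_int_mod_ring (int i - 1)"

lemma of_int_mod_ring_eq_iff:
  "(of_int_mod_ring x :: 'n::finite mod_ring) = of_int_mod_ring y
     \<longleftrightarrow> x mod int CARD('n) = y mod int CARD('n)"
  by transfer simp

lemma of_int_mod_ring_diff:
  "of_int_mod_ring x - of_int_mod_ring y = (of_int_mod_ring (x - y) :: 'n::finite mod_ring)"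
  by transfer (simp add: mod_diff_eq)

lemma residue_eq_iff:
  assumes "i \<in> {1..CARD('n::finite)}" "j \<in> {1..CARD('n)}"
  shows "(residue i :: 'n mod_ring) = residue j \<longleftrightarrow> i = j"
  using assms by (auto simp: of_int_mod_ring_eq_iff)

lemma residue_cases:
  obtains i where "i \<in> {1..CARD('n::finite)}" "a = (residue i :: 'n mod_ring)"
proof -
  have "to_int_mod_ring a \<in> {0..<int CARD('n)}"
    using range_to_int_mod_ring by blast
  then show ?thesis
    using that[of "nat (to_int_mod_ring a) + 1"] by auto
qed

lemma dual_basis_dual: "dual_basis i \<in> dual"
  using lookup_dual by (simp add: dual_basis_def[abs_def])

lemma dual_basis_basis:
  assumes "i \<in> {1..CARD('n::finite)}" "j \<in> {1..CARD('n)}"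
  shows "dual_basis j (basis i :: 'n mod_ring \<Rightarrow>\<^sub>0 'k::field) = (if i = j then 1 else 0)"
  using assms by (simp add: dual_basis_def basis_def lookup_single when_def residue_eq_iff)

lemma dual_eqI_basis:
  fixes \<phi> :: "('n::finite mod_ring \<Rightarrow>\<^sub>0 'k::field) \<Rightarrow> 'k"
  assumes "\<phi> \<in> dual" "\<psi> \<in> dual"
    and "\<And>i. i \<in> {1..CARD('n)} \<Longrightarrow> \<phi> (basis i) = \<psi> (basis i)"
  shows "\<phi> = \<psi>"
proof (rule dual_eqI[OF assms(1,2)])
  fix a :: "'n mod_ring"
  obtain i where "i \<in> {1..CARD('n)}" "a = residue i" by (rule residue_cases)
  then show "\<phi> (gelem a) = \<psi> (gelem a)"
    using assms(3)[of i] by (simp add: basis_def)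
qed

lemma dual_expansion:
  fixes \<phi> :: "('n::finite mod_ring \<Rightarrow>\<^sub>0 'k::field) \<Rightarrow> 'k"
  assumes "\<phi> \<in> dual"
  shows "\<phi> = (\<lambda>h. \<Sum>j=1..CARD('n). \<phi> (basis j) * dual_basis j h)"
  using assms
  by (intro dual_eqI_basis) (auto intro!: dual_intros dual_basis_dual
      simp: dual_basis_basis if_distrib cong: if_cong)

lemma End_dual_linear_combination:
  assumes "f \<in> End_dual" "\<And>j. j \<in> J \<Longrightarrow> \<phi> j \<in> dual"
  shows "f (\<lambda>h. \<Sum>j\<in>J. c j * \<phi> j h) = (\<lambda>h. \<Sum>j\<in>J. c j * f (\<phi> j) h)"
proof -
  have add: "f (\<lambda>h. \<phi> h + \<psi> h) = (\<lambda>h. f \<phi> h + f \<psi> h)"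
    if "\<phi> \<in> dual" "\<psi> \<in> dual" for \<phi> \<psi>
    using assms(1) that by (auto simp: End_dual_def)
  have scale: "f (\<lambda>h. b * \<phi> h) = (\<lambda>h. b * f \<phi> h)" if "\<phi> \<in> dual" for \<phi> b
    using assms(1) that by (auto simp: End_dual_def)
  have "f (\<lambda>_. 0) = (\<lambda>_. 0)"
    using scale[of "\<lambda>_. 0" 0] by (simp add: zero_dual)
  then show ?thesis
    using assms(2)
    by (induction J rule: infinite_finite_induct)
      (auto simp: add scale sum_dual scale_dual zero_dual)
qed

text \<open>
  The defining equations of the matrix of \<open>f\<close> expand \<open>f p_j\<close> in the dual basis. Evaluation at
  \<open>e_i\<close> picks out the coefficient of \<open>p_i\<close>, which turns the description of the matrix into a
  formula for its entries.
\<close>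

lemma matrix_of_eq:
  fixes f :: "(('n::finite mod_ring \<Rightarrow>\<^sub>0 'k::field) \<Rightarrow> 'k) \<Rightarrow> ('n mod_ring \<Rightarrow>\<^sub>0 'k) \<Rightarrow> 'k"
  assumes "f \<in> End_dual"
  shows "matrix_of f =
    mat CARD('n) CARD('n) (\<lambda>(i, j). f (dual_basis (j + 1)) (basis (i + 1)))" (is "_ = ?M")
  unfolding matrix_of_def
proof (rule the_equality)
  \<comment> \<open>Existence: the coefficients of a form in the dual basis are its values on the basis.\<close>
  have "f (dual_basis j) = (\<lambda>h. \<Sum>i=1..CARD('n). ?M $$ (i - 1, j - 1) * dual_basis i h)"
    if j: "j \<in> {1..CARD('n)}" for j
  proof -
    have "f (dual_basis j) = (\<lambda>h. \<Sum>i=1..CARD('n). f (dual_basis j) (basis i) * dual_basis i h)"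
      by (intro dual_expansion End_dual_closed[OF assms] dual_basis_dual)
    also have "\<dots> = (\<lambda>h. \<Sum>i=1..CARD('n). ?M $$ (i - 1, j - 1) * dual_basis i h)"
      using j by (intro ext sum.cong) auto
    finally show ?thesis .
  qed
  then show "?M \<in> carrier_mat CARD('n) CARD('n) \<and> (\<forall>j\<in>{1..CARD('n)}. f (dual_basis j) =
      (\<lambda>h. \<Sum>i=1..CARD('n). ?M $$ (i - 1, j - 1) * dual_basis i h))"
    by (intro conjI ballI mat_carrier)
next
  fix A
  assume A: "A \<in> carrier_mat CARD('n) CARD('n) \<and> (\<forall>j\<in>{1..CARD('n)}. f (dual_basis j) =
      (\<lambda>h. \<Sum>i=1..CARD('n). A $$ (i - 1, j - 1) * dual_basis i h))"
  \<comment> \<open>Uniqueness: evaluation of the defining equations at a basis vector leaves one entry.\<close>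
  have "f (dual_basis (j + 1)) (basis (i + 1)) = A $$ (i, j)"
    if "i < CARD('n)" "j < CARD('n)" for i j
  proof -
    have "f (dual_basis (j + 1)) (basis (i + 1)) =
        (\<Sum>k=1..CARD('n). A $$ (k - 1, j) * dual_basis k (basis (i + 1) :: 'n mod_ring \<Rightarrow>\<^sub>0 'k))"
      using A that by simp
    also have "\<dots> = (\<Sum>k=1..CARD('n). if k = i + 1 then A $$ (k - 1, j) else 0)"
      using that by (intro sum.cong) (auto simp: dual_basis_basis)
    also have "\<dots> = A $$ (i, j)"
      using that by simp
    finally show ?thesis .
  qed
  then show "A = ?M"
    using A by (intro eq_matI) auto
qed

lemma matrix_of_carrier:
  "f \<in> End_dual \<Longrightarrow>
    matrix_of (f :: (('n::finite mod_ring \<Rightarrow>\<^sub>0 'k::field) \<Rightarrow> 'k) \<Rightarrow> _) \<in> carrier_mat CARD('n) CARD('n)"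
  by (simp add: matrix_of_eq)

lemma compose_End_dual:
  assumes "f \<in> End_dual" "g \<in> End_dual"
  shows "compose dual f g \<in> End_dual"
  using assms unfolding compose_def
  by (intro End_dualI) (auto simp: End_dual_def PiE_iff)

lemma matrix_of_compose:
  fixes f g :: "(('n::finite mod_ring \<Rightarrow>\<^sub>0 'k::field) \<Rightarrow> 'k) \<Rightarrow> ('n mod_ring \<Rightarrow>\<^sub>0 'k) \<Rightarrow> 'k"
  assumes f: "f \<in> End_dual" and g: "g \<in> End_dual"
  shows "matrix_of (compose dual f g) = matrix_of f * matrix_of g"
proof (rule eq_matI)
  let ?n = "CARD('n)"
  fix i j assume "i < dim_row (matrix_of f * matrix_of g)" "j < dim_col (matrix_of f * matrix_of g)"
  then have ij: "i < ?n" "j < ?n"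
    using matrix_of_carrier[OF f] matrix_of_carrier[OF g] by auto
  let ?p = "dual_basis (j + 1) :: ('n mod_ring \<Rightarrow>\<^sub>0 'k) \<Rightarrow> 'k"
  have "f (g ?p) = f (\<lambda>h. \<Sum>k=1..?n. g ?p (basis k) * dual_basis k h)"
    using dual_expansion[OF End_dual_closed[OF g dual_basis_dual]] by simp
  also have "\<dots> = (\<lambda>h. \<Sum>k=1..?n. g ?p (basis k) * f (dual_basis k) h)"
    by (rule End_dual_linear_combination[OF f dual_basis_dual])
  finally have "f (g ?p) (basis (i + 1)) =
      (\<Sum>k<?n. g ?p (basis (k + 1)) * f (dual_basis (k + 1)) (basis (i + 1)))"
    by (simp add: sum.atLeast1_atMost_eq)
  then show "matrix_of (compose dual f g) $$ (i, j) = (matrix_of f * matrix_of g) $$ (i, j)"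
    using ij by (simp add: matrix_of_eq f g compose_End_dual compose_eq dual_basis_dual
        scalar_prod_def atLeast0LessThan mult.commute)
qed (use assms in \<open>auto simp: matrix_of_eq compose_End_dual\<close>)

text \<open>
  An endomorphism is determined by its values on the dual basis, and these by their values on the
  basis, whence injectivity. For surjectivity, the matrix \<open>A\<close> itself prescribes an endomorphism.
\<close>

lemma matrix_of_iso:
  "(matrix_of :: ((('n::finite mod_ring \<Rightarrow>\<^sub>0 'k::field) \<Rightarrow> 'k) \<Rightarrow> _) \<Rightarrow> 'k mat)
     \<in> alg_iso End_dual_alg (matrix_alg CARD('n))"
proof -
  let ?n = "CARD('n)"
  let ?m = "matrix_of :: ((('n mod_ring \<Rightarrow>\<^sub>0 'k) \<Rightarrow> 'k) \<Rightarrow> _) \<Rightarrow> 'k mat"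
  have "?m \<in> alg_hom End_dual_alg (matrix_alg ?n)"
  proof (rule alg_homI, simp_all add: End_dual_alg_def matrix_alg_def)
    fix f g :: "(('n mod_ring \<Rightarrow>\<^sub>0 'k) \<Rightarrow> 'k) \<Rightarrow> ('n mod_ring \<Rightarrow>\<^sub>0 'k) \<Rightarrow> 'k"
    assume f: "f \<in> End_dual"
    show "?m f \<in> carrier_mat ?n ?n" using f by (rule matrix_of_carrier)
    have "(\<lambda>\<phi>\<in>dual. \<lambda>h. c * f \<phi> h) \<in> End_dual" for c
      using f by (intro End_dualI) (auto simp: End_dual_def PiE_iff scale_dual algebra_simps)
    then show "?m (\<lambda>\<phi>\<in>dual. \<lambda>h. c * f \<phi> h) = c \<cdot>\<^sub>m ?m f" for c
      using f by (intro eq_matI) (auto simp: matrix_of_eq dual_basis_dual)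
    assume g: "g \<in> End_dual"
    show "?m (compose dual f g) = ?m f * ?m g" using f g by (rule matrix_of_compose)
    have "(\<lambda>\<phi>\<in>dual. \<lambda>h. f \<phi> h + g \<phi> h) \<in> End_dual"
      using f g by (intro End_dualI) (auto simp: End_dual_def PiE_iff add_dual algebra_simps)
    then show "?m (\<lambda>\<phi>\<in>dual. \<lambda>h. f \<phi> h + g \<phi> h) = ?m f + ?m g"
      using f g by (intro eq_matI) (auto simp: matrix_of_eq dual_basis_dual)
  next
    have "(\<lambda>\<phi>\<in>dual. \<phi>) \<in> (End_dual :: ((('n mod_ring \<Rightarrow>\<^sub>0 'k) \<Rightarrow> 'k) \<Rightarrow> _) set)"
      by (intro End_dualI) auto
    then show "?m (\<lambda>\<phi>\<in>dual. \<phi>) = 1\<^sub>m ?n"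
      by (intro eq_matI) (auto simp: matrix_of_eq dual_basis_dual dual_basis_basis)
  qed
  moreover have "bij_betw ?m End_dual (carrier_mat ?n ?n)"
  proof (rule bij_betw_imageI)
    show "inj_on ?m End_dual"
    proof (rule inj_onI)
      fix f g :: "(('n mod_ring \<Rightarrow>\<^sub>0 'k) \<Rightarrow> 'k) \<Rightarrow> ('n mod_ring \<Rightarrow>\<^sub>0 'k) \<Rightarrow> 'k"
      assume f: "f \<in> End_dual" and g: "g \<in> End_dual" and eq: "?m f = ?m g"
      have entries: "f (dual_basis j) (basis i) = g (dual_basis j) (basis i)"
        if "i \<in> {1..?n}" "j \<in> {1..?n}" for i j
        using arg_cong[OF eq, of "\<lambda>A. A $$ (i - 1, j - 1)"] that f g by (auto simp: matrix_of_eq)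
      \<comment> \<open>Equal entries first give equality on the dual basis, then by linearity everywhere.\<close>
      have on_basis: "f (dual_basis j) = g (dual_basis j)" if "j \<in> {1..?n}" for j
        using that entries by (intro dual_eqI_basis End_dual_closed[OF f] End_dual_closed[OF g]
            dual_basis_dual) auto
      have "f \<in> dual \<rightarrow>\<^sub>E dual" "g \<in> dual \<rightarrow>\<^sub>E dual"
        using f g by (auto simp: End_dual_def)
      then show "f = g"
      proof (rule PiE_ext)
        fix \<phi> :: "('n mod_ring \<Rightarrow>\<^sub>0 'k) \<Rightarrow> 'k"
        assume "\<phi> \<in> dual"
        then have \<phi>: "\<phi> = (\<lambda>h. \<Sum>j=1..?n. \<phi> (basis j) * dual_basis j h)"
          by (rule dual_expansion)
        have "f (\<lambda>h. \<Sum>j=1..?n. \<phi> (basis j) * dual_basis j h)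
            = g (\<lambda>h. \<Sum>j=1..?n. \<phi> (basis j) * dual_basis j h)"
          unfolding End_dual_linear_combination[OF f dual_basis_dual]
            End_dual_linear_combination[OF g dual_basis_dual]
          using on_basis by simp
        then show "f \<phi> = g \<phi>"
          using \<phi> by simp
      qed
    qed
    show "?m ` End_dual = carrier_mat ?n ?n"
    proof (intro equalityI subsetI)
      fix A :: "'k mat" assume A: "A \<in> carrier_mat ?n ?n"
      \<comment> \<open>Multiplication of coordinate vectors by A; the coordinates of a form are its values on the basis.\<close>
      define f :: "(('n mod_ring \<Rightarrow>\<^sub>0 'k) \<Rightarrow> 'k) \<Rightarrow> ('n mod_ring \<Rightarrow>\<^sub>0 'k) \<Rightarrow> 'k" where
        "f = (\<lambda>\<phi>\<in>dual. \<lambda>h. \<Sum>i=1..?n.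
          (\<Sum>j=1..?n. A $$ (i - 1, j - 1) * \<phi> (basis j)) * dual_basis i h)"
      have f: "f \<in> End_dual"
        unfolding f_def
        by (intro End_dualI dual_intros dual_basis_dual)
          (auto simp: algebra_simps sum.distrib sum_distrib_left)
      have "f (dual_basis (j + 1)) (basis (i + 1)) = A $$ (i, j)" if "i < ?n" "j < ?n" for i j
      proof -
        have "f (dual_basis (j + 1)) (basis (i + 1)) =
            (\<Sum>k=1..?n. A $$ (k - 1, j) * dual_basis k (basis (i + 1) :: 'n mod_ring \<Rightarrow>\<^sub>0 'k))"
          using that unfolding f_def
          by (auto simp: dual_basis_dual dual_basis_basis[where 'n='n] if_distrib[of "(*) _"]
              intro!: sum.cong cong: if_cong)
        also have "\<dots> = (\<Sum>k=1..?n. if k = i + 1 then A $$ (k - 1, j) else 0)"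
          using that by (intro sum.cong) (auto simp: dual_basis_basis)
        also have "\<dots> = A $$ (i, j)" using that by simp
        finally show ?thesis .
      qed
      then have "?m f = A"
        using A f by (intro eq_matI) (auto simp: matrix_of_eq)
      then show "A \<in> ?m ` End_dual" using f by blast
    qed (auto simp: matrix_of_carrier)
  qed
  ultimately show ?thesis
    by (simp add: alg_iso_def End_dual_alg_def matrix_alg_def)
qed


section \<open>The two images\<close>

lemma lambda_dual_End: "\<phi> \<in> dual \<Longrightarrow> lambda_dual \<phi> \<in> End_dual"
  using lambda_dual_embedding
  by (auto simp: alg_embedding_def alg_hom_def Ring.ring_hom_def dual_alg_def End_dual_alg_def)

text \<open>
  Since \<open>(\<phi> * p_j)(e_i) = \<phi>(e_i) p_j(e_i)\<close>, the dual basis consists of eigenvectors of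
  convolution by \<open>\<phi>\<close>.
\<close>

lemma matrix_of_lambda_dual:
  fixes \<phi> :: "('n::finite mod_ring \<Rightarrow>\<^sub>0 'k::field) \<Rightarrow> 'k"
  assumes "\<phi> \<in> dual"
  shows "matrix_of (lambda_dual \<phi>) =
    mat CARD('n) CARD('n) (\<lambda>(i, j). if i = j then \<phi> (basis (i + 1)) else 0)"
    (is "_ = ?D")
proof (rule eq_matI)
  fix i j assume "i < dim_row ?D" "j < dim_col ?D"
  then have ij: "i < CARD('n)" "j < CARD('n)" by auto
  have "lambda_dual \<phi> (dual_basis (j + 1)) (basis (i + 1))
      = \<phi> (basis (i + 1)) * dual_basis (j + 1) (basis (i + 1) :: 'n mod_ring \<Rightarrow>\<^sub>0 'k)"
    by (simp add: lambda_dual_def dual_basis_dual) (simp add: basis_def)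
  then show "matrix_of (lambda_dual \<phi>) $$ (i, j) = ?D $$ (i, j)"
    using ij by (simp add: matrix_of_eq lambda_dual_End assms dual_basis_basis)
qed (simp_all add: matrix_of_eq lambda_dual_End assms)

lemma image_lambda_dual:
  "(\<lambda>\<phi> :: ('n::finite mod_ring \<Rightarrow>\<^sub>0 'k::field) \<Rightarrow> 'k. matrix_of (lambda_dual \<phi>)) ` dual
     = diagonals CARD('n)"
proof (intro equalityI subsetI)
  let ?n = "CARD('n)"
  fix A :: "'k mat" assume A: "A \<in> diagonals ?n"
  define \<phi> :: "('n mod_ring \<Rightarrow>\<^sub>0 'k) \<Rightarrow> 'k" where
    "\<phi> = (\<lambda>h. \<Sum>i=1..?n. A $$ (i - 1, i - 1) * dual_basis i h)"
  have \<phi>: "\<phi> \<in> dual"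
    unfolding \<phi>_def by (intro dual_intros dual_basis_dual)
  have "\<phi> (basis (i + 1)) = A $$ (i, i)" if "i < ?n" for i
  proof -
    have "\<phi> (basis (i + 1)) = (\<Sum>k=1..?n. if k = i + 1 then A $$ (k - 1, k - 1) else 0)"
      unfolding \<phi>_def using that by (intro sum.cong) (auto simp: dual_basis_basis)
    then show ?thesis using that by simp
  qed
  then have "matrix_of (lambda_dual \<phi>) = A"
    using A \<phi> by (intro eq_matI) (auto simp: matrix_of_lambda_dual diagonals_def diagonal_mat_def)
  then show "A \<in> (\<lambda>\<phi> :: ('n mod_ring \<Rightarrow>\<^sub>0 'k) \<Rightarrow> 'k. matrix_of (lambda_dual \<phi>)) ` dual"
    using \<phi> by blast
qed (auto simp: matrix_of_lambda_dual diagonals_def diagonal_mat_def)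

lemma lambda_alg_End: "lambda_alg h \<in> End_dual"
  using lambda_alg_embedding
  by (auto simp: alg_embedding_def alg_hom_def Ring.ring_hom_def group_alg_def End_dual_alg_def)

text \<open>
  The \<open>(i, j)\<close> entry is \<open>p_j(e_i h)\<close>, the coefficient of \<open>h\<close> at the difference of the residues
  with indices \<open>j\<close> and \<open>i\<close>. It depends only on \<open>j - i\<close> modulo \<open>n\<close>.
\<close>

lemma matrix_of_lambda_alg: "matrix_of (lambda_alg h) = circ_map h"
  for h :: "'n::finite mod_ring \<Rightarrow>\<^sub>0 'k::field"
proof (rule eq_matI)
  fix i j assume "i < dim_row (circ_map h)" "j < dim_col (circ_map h)"
  then have ij: "i < CARD('n)" "j < CARD('n)" by (simp_all add: circ_map_def circ_def)
  let ?d = "nat ((int j - int i) mod int CARD('n))"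
  have "residue (j + 1) - residue (i + 1) = (of_int_mod_ring (int j - int i) :: 'n mod_ring)"
    by (simp add: of_int_mod_ring_diff)
  \<comment> \<open>The residue class m is the basis index m + 1.\<close>
  also have "\<dots> = residue (?d + 1)"
    by (simp add: of_int_mod_ring_eq_iff)
  finally have "lambda_alg h (dual_basis (j + 1)) (basis (i + 1)) = dual_basis (?d + 1) h"
    by (simp only: lambda_alg_def restrict_apply' dual_basis_dual act_def)
      (simp only: dual_basis_def basis_def lookup_gelem_mult uminus_add_conv_diff)
  then show "matrix_of (lambda_alg h) $$ (i, j) = circ_map h $$ (i, j)"
    using ij by (simp add: matrix_of_eq lambda_alg_End circ_map_def circ_def)
qed (simp_all add: matrix_of_eq lambda_alg_End circ_map_def circ_def)

lemma circ_map_sum: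
  "circ_map (\<Sum>i=1..CARD('n). gscale (c i) (basis i :: 'n::finite mod_ring \<Rightarrow>\<^sub>0 'k::field))
     = circ CARD('n) c"
proof -
  let ?n = "CARD('n)"
  let ?h = "\<Sum>i=1..?n. gscale (c i) (basis i :: 'n mod_ring \<Rightarrow>\<^sub>0 'k)"
  have coeff: "dual_basis k ?h = c k" if "k \<in> {1..?n}" for k
  proof -
    have "dual_basis k ?h = (\<Sum>i=1..?n. c i * dual_basis k (basis i :: 'n mod_ring \<Rightarrow>\<^sub>0 'k))"
      by (simp add: dual_basis_def lookup_sum)
    also have "\<dots> = (\<Sum>i=1..?n. if i = k then c i else 0)"
      using that by (intro sum.cong) (auto simp: dual_basis_basis)
    finally show ?thesis using that by simp
  qed
  \<comment> \<open>Only the arguments 1, ..., n of c occur in the circulant matrix.\<close>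
  have index: "nat (x mod int ?n) + 1 \<in> {1..?n}" for x
    by (simp add: nat_less_iff Suc_le_eq)
  show ?thesis
    unfolding circ_map_def circ_def
    by (rule arg_cong[where f="mat ?n ?n"]) (simp only: coeff[OF index])
qed

lemma range_circ_map:
  "range (circ_map :: ('n::finite mod_ring \<Rightarrow>\<^sub>0 'k::field) \<Rightarrow> 'k mat) = circulants CARD('n)"
  unfolding circulants_def
proof (intro equalityI subsetI)
  fix A :: "'k mat" assume "A \<in> range (circ CARD('n))"
  then obtain c where "A = circ CARD('n) c" by blast
  then have "A = circ_map (\<Sum>i=1..CARD('n). gscale (c i) (basis i :: 'n mod_ring \<Rightarrow>\<^sub>0 'k))"
    by (simp only: circ_map_sum)
  then show "A \<in> range (circ_map :: ('n mod_ring \<Rightarrow>\<^sub>0 'k) \<Rightarrow> 'k mat)"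
    by blast
qed (auto simp: circ_map_def)

lemma image_lambda_alg:
  "(\<lambda>h :: 'n::finite mod_ring \<Rightarrow>\<^sub>0 'k::field. matrix_of (lambda_alg h)) ` UNIV
     = circulants CARD('n)"
  by (simp only: matrix_of_lambda_alg range_circ_map)

text \<open>
  The map inherits multiplicativity and injectivity from \<open>\<lambda>\<close> and from the isomorphism between
  endomorphisms and matrices.
\<close>

lemma circ_map_iso:
  "(circ_map :: ('n::finite mod_ring \<Rightarrow>\<^sub>0 'k::field) \<Rightarrow> 'k mat)
     \<in> alg_iso group_alg (circulant_alg CARD('n))"
proof -
  have "(circ_map :: ('n mod_ring \<Rightarrow>\<^sub>0 'k) \<Rightarrow> 'k mat) \<in> alg_embedding group_alg (matrix_alg CARD('n))"
    using alg_embedding_comp_iso[OF lambda_alg_embedding matrix_of_iso]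
    by (simp add: comp_def matrix_of_lambda_alg)
  from alg_embedding_onto_image[OF this] show ?thesis
    by (simp add: circulant_alg_def group_alg_def range_circ_map)
qed

theorem proposition3p1:
  fixes n :: nat
  assumes "n = CARD('n::finite)"
  shows
    "(matrix_of :: ((('n mod_ring \<Rightarrow>\<^sub>0 'k::field_char_0) \<Rightarrow> 'k) \<Rightarrow> _) \<Rightarrow> 'k mat)
       \<in> alg_iso End_dual_alg (matrix_alg n) \<and>
     (lambda_dual :: (('n mod_ring \<Rightarrow>\<^sub>0 'k) \<Rightarrow> 'k) \<Rightarrow> _)
       \<in> alg_embedding dual_alg End_dual_alg \<and>
     (lambda_alg :: ('n mod_ring \<Rightarrow>\<^sub>0 'k) \<Rightarrow> _) \<in> alg_embedding group_alg End_dual_alg \<and>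
     (\<lambda>\<phi> :: ('n mod_ring \<Rightarrow>\<^sub>0 'k) \<Rightarrow> 'k. matrix_of (lambda_dual \<phi>)) ` dual = diagonals n \<and>
     (\<lambda>h :: 'n mod_ring \<Rightarrow>\<^sub>0 'k. matrix_of (lambda_alg h)) ` UNIV = circulants n \<and>
     (circ_map :: ('n mod_ring \<Rightarrow>\<^sub>0 'k) \<Rightarrow> 'k mat) \<in> alg_iso group_alg (circulant_alg n) \<and>
     (\<forall>c. circ_map (\<Sum>i = 1..n. gscale (c i) (basis i :: 'n mod_ring \<Rightarrow>\<^sub>0 'k)) = circ n c) \<and>
     (\<forall>h :: 'n mod_ring \<Rightarrow>\<^sub>0 'k. matrix_of (lambda_alg h) = circ_map h)"
  unfolding assms
  by (intro conjI allI)
    (rule matrix_of_iso lambda_dual_embedding lambda_alg_embedding image_lambda_dual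
      image_lambda_alg circ_map_iso circ_map_sum matrix_of_lambda_alg)+

end
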